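(* Let $n\geq 5$ and let $f:\{0,1\}^n\to\{0,1\}^n$ be a Boolean network which is neither a constant map nor the identity map. Then $K_n\in\mathcal{G}(f)$.
   Context: A Boolean network with $n$ components is a map $f:\{0,1\}^n\to\{0,1\}^n$, $x\mapsto(f_1(x),\dots,f_n(x))$. For $i\in[n]=\{1,\dots,n\}$, $e_i$ denotes the configuration with a $1$ exactly in component $i$, and $x+y$ denotes componentwise addition modulo 2. The interaction graph $G(f)$ is the digraph with vertex set $[n]$ having an arc from $j$ to $i$ (loops $i=j$ allowed) if and only if there is $x\in\{0,1\}^n$ with $f_i(x)\neq f_i(x+e_j)$. Two networks $f,h$ with $n$ components are isomorphic if $h\circ\pi=\pi\circ f$ for some permutation $\pi$ of $\{0,1\}^n$. $\mathcal{G}(f)$ is the set of interaction graphs $G(h)$ of all networks $h$ isomorphic to $f$. $K_n$ denotes the complete digraph on $[n]$ with all $n^2$ arcs (including all loops). *)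

theory Defs
  imports
    Complex_Main
    "HOL-Library.Z2"
    "HOL-Library.Function_Algebras"
    "Graph_Theory.Pair_Digraph"
begin

text \<open>
  The cube \<open>{0,1}\<^sup>n\<close> is represented by the functions on \<open>nat\<close> with values in the two-element
  field that vanish outside \<open>{1..n}\<close>, so that each configuration has exactly one representative
  and the pointwise sum of functions is componentwise addition modulo 2.
\<close>

definition configs :: "nat \<Rightarrow> (nat \<Rightarrow> bit) set" where
  "configs n = {x. \<forall>i. i \<notin> {1..n} \<longrightarrow> x i = 0}"

definition unit_config :: "nat \<Rightarrow> nat \<Rightarrow> bit" where
  "unit_config j = (\<lambda>i. if i = j then 1 else 0)"

text \<open>The values of a network outside \<^term>\<open>configs n\<close> are irrelevant and never inspected.\<close>

definition boolean_network :: "nat \<Rightarrow> ((nat \<Rightarrow> bit) \<Rightarrow> (nat \<Rightarrow> bit)) \<Rightarrow> bool" where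
  "boolean_network n f \<longleftrightarrow> f \<in> configs n \<rightarrow> configs n"

text \<open>An arc from \<open>j\<close> to \<open>i\<close> is the pair \<open>(j, i)\<close>; loops are allowed.\<close>

definition interaction_graph ::
    "nat \<Rightarrow> ((nat \<Rightarrow> bit) \<Rightarrow> (nat \<Rightarrow> bit)) \<Rightarrow> nat pair_pre_digraph" where
  "interaction_graph n f =
     \<lparr> pverts = {1..n},
       parcs = {(j, i). j \<in> {1..n} \<and> i \<in> {1..n} \<and>
                  (\<exists>x\<in>configs n. f x i \<noteq> f (x + unit_config j) i)} \<rparr>"

definition isomorphic_networks ::
    "nat \<Rightarrow> ((nat \<Rightarrow> bit) \<Rightarrow> (nat \<Rightarrow> bit)) \<Rightarrow> ((nat \<Rightarrow> bit) \<Rightarrow> (nat \<Rightarrow> bit)) \<Rightarrow> bool" where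
  "isomorphic_networks n f h \<longleftrightarrow>
     (\<exists>\<pi>. bij_betw \<pi> (configs n) (configs n) \<and> (\<forall>x\<in>configs n. h (\<pi> x) = \<pi> (f x)))"

definition interaction_graphs ::
    "nat \<Rightarrow> ((nat \<Rightarrow> bit) \<Rightarrow> (nat \<Rightarrow> bit)) \<Rightarrow> nat pair_pre_digraph set" where
  "interaction_graphs n f =
     {interaction_graph n h | h. boolean_network n h \<and> isomorphic_networks n f h}"

text \<open>All \<open>n\<^sup>2\<close> arcs, including the loops (unlike the usual loopless complete digraph).\<close>

definition full_digraph :: "nat \<Rightarrow> nat pair_pre_digraph" where
  "full_digraph n = \<lparr> pverts = {1..n}, parcs = {1..n} \<times> {1..n} \<rparr>"

end

(*
  It suffices to place finitely many points of the cube injectively so that for every direction j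
  two of them become neighbours x, x + e_j whose images differ in component i; the placement then
  extends to a permutation. If the images are antipodal, one such pair yields all arcs out of j.
  - 2n fixed points: place a moved point a at 0, f a at 11..1, and fixed points at weights 1 and 2.
  - A fibre of size n + 2: place n points of it around a point with another image.
  - n disjoint triples x, f x, f (f x): place x next to f x and f (f x) antipodal to f x.
  - Otherwise there is a set A of 2n points with f A disjoint from A and with all fibres small.
    Pair up the fibres of A (discarding the smallest one if their number is odd), place each pair
    of fibres of sizes s, t as the two colour classes of a tree in the cube whose s + t - 1 edges
    have distinct directions, and place the two images of each pair of fibres antipodally.
*)

theory Submission
  imports Defs
begin

section \<open>The cube as a vector space over the two-element field\<close>

text \<open>Adding this vector takes a configuration to its antipode. Two antipodal images differ in
  every component \<open>i\<close> at once.\<close>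

definition all_ones :: "nat \<Rightarrow> nat \<Rightarrow> bit" where
  "all_ones n = (\<lambda>i. if i \<in> {1..n} then 1 else 0)"

lemma config_add_self [simp]: "x + x = (0 :: nat \<Rightarrow> bit)"
  by (rule ext) simp

lemma config_add_self_left [simp]: "x + (x + y) = (y :: nat \<Rightarrow> bit)"
  using add.assoc[of x x y] by simp

text \<open>Subtraction is addition in characteristic 2. Hence adjacency in a direction is
  symmetric, which lets \<open>tree_placement\<close> exchange its two colour classes.\<close>

lemma config_add_eq_iff: "x + y = z \<longleftrightarrow> x = z + (y :: nat \<Rightarrow> bit)"
proof -
  have "a + y + y = a" for a by (simp add: add.assoc)
  then show ?thesis by metis
qed

lemma unit_config_apply: "unit_config j i = (if i = j then 1 else 0)"
  by (simp add: unit_config_def)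

lemma inj_unit_config: "inj unit_config"
  by (rule injI) (metis unit_config_apply zero_neq_one)

lemma configs_add: "x \<in> configs n \<Longrightarrow> y \<in> configs n \<Longrightarrow> x + y \<in> configs n"
  by (simp add: configs_def)

lemma zero_in_configs: "0 \<in> configs n"
  by (simp add: configs_def)

lemma unit_config_in_configs: "j \<in> {1..n} \<Longrightarrow> unit_config j \<in> configs n"
  by (auto simp: configs_def unit_config_def)

lemma all_ones_in_configs: "all_ones n \<in> configs n"
  by (auto simp: configs_def all_ones_def)

lemma all_ones_apply: "i \<in> {1..n} \<Longrightarrow> all_ones n i = 1"
  by (simp add: all_ones_def)

text \<open>A configuration is determined by its support; this yields the finiteness of the cube and
  its size \<open>2 ^ n\<close>.\<close>

lemma bij_betw_configs_Pow: "bij_betw (\<lambda>x. {i. x i = 1}) (configs n) (Pow {1..n})"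
proof (rule bij_betw_byWitness[where f' = "\<lambda>C i. if i \<in> C then 1 else 0"])
  show "\<forall>x\<in>configs n. (\<lambda>i. if i \<in> {i. x i = 1} then 1 else 0) = x"
    by (auto simp: fun_eq_iff)
  show "\<forall>C\<in>Pow {1..n}. {i. (if i \<in> C then 1 else 0) = (1::bit)} = C" by auto
  show "(\<lambda>x. {i. x i = 1}) ` configs n \<subseteq> Pow {1..n}"
    by (force simp: configs_def)
  show "(\<lambda>C i. if i \<in> C then 1 else (0::bit)) ` Pow {1..n} \<subseteq> configs n"
    by (auto simp: configs_def)
qed

lemma finite_configs: "finite (configs n)"
  using bij_betw_finite[OF bij_betw_configs_Pow] by simp

lemma card_configs: "card (configs n) = 2 ^ n"
  using bij_betw_same_card[OF bij_betw_configs_Pow, of n] by (simp add: card_Pow)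

section \<open>From partial placements to isomorphic networks\<close>

lemma inj_on_extend_bij:
  assumes "finite V" "S \<subseteq> V" "inj_on g S" "g ` S \<subseteq> V"
  obtains \<pi> where "bij_betw \<pi> V V" "\<And>x. x \<in> S \<Longrightarrow> \<pi> x = g x"
proof -
  have "card (V - S) = card (V - g ` S)"
    using assms by (simp add: card_Diff_subset finite_subset card_image)
  then obtain k where k: "bij_betw k (V - S) (V - g ` S)"
    using finite_same_card_bij[of "V - S" "V - g ` S"] assms(1) by auto
  have "bij_betw (\<lambda>x. if x \<in> S then g x else k x) (S \<union> (V - S)) (g ` S \<union> (V - g ` S))"
  proof (rule bij_betw_combine)
    show "bij_betw (\<lambda>x. if x \<in> S then g x else k x) S (g ` S)"
      using assms(3) by (simp add: bij_betw_def inj_on_def)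
    show "bij_betw (\<lambda>x. if x \<in> S then g x else k x) (V - S) (V - g ` S)"
      using k by (subst bij_betw_cong[of _ _ k]) auto
  qed auto
  moreover have "S \<union> (V - S) = V" "g ` S \<union> (V - g ` S) = V" using assms by auto
  ultimately show thesis using that[of "\<lambda>x. if x \<in> S then g x else k x"] by auto
qed

text \<open>Extend \<open>g\<close> to a permutation \<open>\<pi>\<close> and conjugate
  \<open>f\<close> by it. The resulting \<open>h\<close> sends \<open>g p\<close> to
  \<open>g (f p)\<close> whenever \<open>p\<close> and \<open>f p\<close> lie in \<open>S\<close>,
  so the pair \<open>p\<close>, \<open>q\<close> witnesses the arc from \<open>j\<close> to
  \<open>i\<close>. All later cases only construct \<open>S\<close> and \<open>g\<close>.\<close>

lemma full_digraph_if_placement: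
  assumes f: "boolean_network n f"
    and S: "S \<subseteq> configs n" "inj_on g S" "g ` S \<subseteq> configs n"
    and arcs: "\<And>i j. i \<in> {1..n} \<Longrightarrow> j \<in> {1..n} \<Longrightarrow>
      \<exists>p\<in>S. \<exists>q\<in>S. f p \<in> S \<and> f q \<in> S \<and> g q = g p + unit_config j \<and> g (f p) i \<noteq> g (f q) i"
  shows "full_digraph n \<in> interaction_graphs n f"
proof -
  obtain \<pi> where \<pi>: "bij_betw \<pi> (configs n) (configs n)" and ext: "\<And>x. x \<in> S \<Longrightarrow> \<pi> x = g x"
    using inj_on_extend_bij[OF finite_configs S] by blast
  define h where "h y = \<pi> (f (inv_into (configs n) \<pi> y))" for y
  have fV: "f x \<in> configs n" if "x \<in> configs n" for x
    using f that by (auto simp: boolean_network_def)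
  have h\<pi>: "h (\<pi> x) = \<pi> (f x)" if "x \<in> configs n" for x
    using \<pi> that by (simp add: h_def bij_betw_def)
  have "h y \<in> configs n" if "y \<in> configs n" for y
    unfolding h_def using \<pi> that fV
    by (metis bij_betw_apply bij_betw_inv_into)
  then have "boolean_network n h" by (auto simp: boolean_network_def)
  moreover have "isomorphic_networks n f h"
    unfolding isomorphic_networks_def using \<pi> h\<pi> by blast
  moreover have "\<exists>x\<in>configs n. h x i \<noteq> h (x + unit_config j) i"
    if ij: "i \<in> {1..n}" "j \<in> {1..n}" for i j
  proof -
    obtain p q where pq: "p \<in> S" "q \<in> S" "f p \<in> S" "f q \<in> S" "g q = g p + unit_config j"
      "g (f p) i \<noteq> g (f q) i"
      using arcs[OF ij] by blast
    then have "h (g p) = g (f p)" "h (g p + unit_config j) = g (f q)"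
      using h\<pi> ext S(1) by (metis subsetD)+
    then show ?thesis using pq S(3) by (intro bexI[of _ "g p"]) auto
  qed
  then have "interaction_graph n h = full_digraph n"
    unfolding interaction_graph_def full_digraph_def by auto
  ultimately show ?thesis unfolding interaction_graphs_def by (metis (mono_tags, lifting) mem_Collect_eq)
qed

section \<open>Networks with many fixed points\<close>

text \<open>With \<open>a\<close> at 0, \<open>f a\<close> at the all-ones vector and a fixed point
  at \<open>unit_config j\<close>, the edge in direction \<open>j\<close> at 0 gives the arcs to
  every \<open>i\<close> other than \<open>j\<close>. The loops come from edges between fixed points
  of weights 1 and 2.\<close>

lemma full_digraph_if_many_fixpoints:
  assumes n: "n \<ge> 3" and f: "boolean_network n f"
    and a: "a \<in> configs n" "f a \<noteq> a"
    and many: "card {x \<in> configs n. f x = x} \<ge> 2 * n"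
  shows "full_digraph n \<in> interaction_graphs n f"
proof -
  let ?e = unit_config
  \<comment> \<open>All points of weight 1, and those of weight 2 whose support contains 1:
    \<open>2 * n - 1\<close> targets for fixed points.\<close>
  define T where "T = ?e ` {1..n} \<union> (\<lambda>k. ?e 1 + ?e k) ` {2..n}"
  have weight1: "?e i \<noteq> ?e 1 + ?e k" if "k \<in> {2..n}" for i k
  proof
    assume eq: "?e i = ?e 1 + ?e k"
    have "?e i 1 = 1" "?e i k = 1" using that by (auto simp: eq unit_config_apply)
    then show False using that by (auto simp: unit_config_apply split: if_splits)
  qed
  have "card T = card (?e ` {1..n}) + card ((\<lambda>k. ?e 1 + ?e k) ` {2..n})"
    unfolding T_def by (rule card_Un_disjoint) (use weight1 in auto)
  also have "card (?e ` {1..n}) = n"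
    using inj_unit_config by (simp add: card_image inj_on_subset)
  also have "card ((\<lambda>k. ?e 1 + ?e k) ` {2..n}) = n - 1"
    using inj_unit_config by (subst card_image) (auto simp: inj_on_def)
  finally have cardT: "card T = 2 * n - 1" using n by simp
  have T_V: "T \<subseteq> configs n"
    using n by (auto simp: T_def intro!: configs_add unit_config_in_configs)
  \<comment> \<open>Weights are at most 2, so three coordinates suffice to tell \<open>T\<close>
    from the all-ones vector.\<close>
  have "t 1 = 0 \<or> t 2 = 0 \<or> t 3 = 0" if "t \<in> T" for t
    using that by (auto simp: T_def unit_config_apply)
  then have ones: "all_ones n \<notin> T" using n by (force simp: all_ones_def)
  have "t \<noteq> 0" if "t \<in> T" for t
    using that weight1 unfolding T_def
    by (auto simp: fun_eq_iff unit_config_apply)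
  then have zero: "0 \<notin> T" by blast
  \<comment> \<open>The point \<open>f a\<close> may itself be fixed, but its place is already
    taken; this costs one of the \<open>2 * n\<close> fixed points.\<close>
  let ?F = "{x \<in> configs n. f x = x} - {f a}"
  have "card ?F \<ge> card T" using many cardT by (auto simp: card_Diff_singleton_if finite_configs)
  then obtain Q where Q: "Q \<subseteq> ?F" "card Q = card T"
    by (meson obtain_subset_with_card_n)
  have finQ: "finite Q" using finite_subset[OF Q(1)] finite_configs by simp
  then obtain r where r: "bij_betw r Q T"
    using finite_same_card_bij[OF finQ _ Q(2)] T_V finite_configs finite_subset by blast
  define g where "g = r(a := 0, f a := all_ones n)"
  have fa: "f a \<in> configs n" using f a by (auto simp: boolean_network_def)
  have notQ: "a \<notin> Q" "f a \<notin> Q" using Q a by auto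
  have gQ: "g q = r q" if "q \<in> Q" for q using that notQ by (auto simp: g_def)
  have ga: "g a = 0" "g (f a) = all_ones n" using a by (auto simp: g_def)
  have ones0: "all_ones n \<noteq> 0" using n by (auto simp: all_ones_def fun_eq_iff intro!: exI[of _ 1])
  show ?thesis
  proof (rule full_digraph_if_placement[OF f, where S = "insert a (insert (f a) Q)" and g = g])
    show "insert a (insert (f a) Q) \<subseteq> configs n" using a fa Q by auto
    show "g ` insert a (insert (f a) Q) \<subseteq> configs n"
      using r T_V gQ ga zero_in_configs all_ones_in_configs by (auto simp: bij_betw_def)
    have "inj_on g Q" using r gQ by (simp add: bij_betw_def inj_on_def)
    moreover have "g ` Q = T" using r gQ by (simp add: bij_betw_def)
    ultimately show "inj_on g (insert a (insert (f a) Q))"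
      using zero ones ones0 ga notQ a(2) by (simp add: insert_Diff_if)
  next
    fix i j assume ij: "i \<in> {1..n}" "j \<in> {1..n}"
    have place: "\<exists>q\<in>Q. g q = t \<and> f q = q" if t: "t \<in> T" for t
      using t r gQ Q by (force simp: bij_betw_def)
    have eT: "?e k \<in> T" if "k \<in> {1..n}" for k using that by (auto simp: T_def)
    show "\<exists>p\<in>insert a (insert (f a) Q). \<exists>q\<in>insert a (insert (f a) Q).
        f p \<in> insert a (insert (f a) Q) \<and> f q \<in> insert a (insert (f a) Q) \<and>
        g q = g p + ?e j \<and> g (f p) i \<noteq> g (f q) i"
    proof (cases "i = j")
      case False
      obtain q where "q \<in> Q" "g q = ?e j" "f q = q" using place[OF eT] ij by blast
      with False ij show ?thesis
        by (intro bexI[of _ a] bexI[of _ q]) (auto simp: ga all_ones_apply unit_config_apply)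
    next
      case True
      \<comment> \<open>The edge at 0 fails for the loop, as both images have a 1 at
        \<open>j\<close>. The fixed points at \<open>?e k\<close> and \<open>?e k + ?e j\<close> do
        differ there, and 1 is one of \<open>j\<close>, \<open>k\<close>, so that their sum lies in
        \<open>T\<close>.\<close>
      define k where "k = (if j = 1 then 2 else 1 :: nat)"
      have "k \<in> {1..n}" using n by (auto simp: k_def)
      then obtain p where p: "p \<in> Q" "g p = ?e k" "f p = p" using place[OF eT] by blast
      have "?e k + ?e j \<in> T"
        using ij n by (auto simp: k_def T_def add.commute)
      then obtain q where q: "q \<in> Q" "g q = ?e k + ?e j" "f q = q" using place by blast
      from p q True show ?thesis
        by (intro bexI[of _ p] bexI[of _ q]) (auto simp: unit_config_apply)
    qed
  qed
qed

section \<open>Networks with a large fibre\<close>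

text \<open>Put \<open>a\<close> at 0 and \<open>n\<close> points of the fibre of \<open>c\<close>
  on its neighbours. If \<open>c\<close> and \<open>f a\<close> are antipodal, every edge at 0 gives
  all arcs out of its direction.\<close>

lemma full_digraph_if_large_fibre:
  assumes n: "n \<ge> 4" and f: "boolean_network n f"
    and a: "a \<in> configs n" "f a \<noteq> c" and c: "c \<in> configs n"
    and fibre: "card {x \<in> configs n. f x = c} \<ge> n + 2"
  shows "full_digraph n \<in> interaction_graphs n f"
proof -
  let ?e = unit_config
  define T where "T = ?e ` {1..n}"
  have cardT: "card T = n"
    using inj_unit_config by (simp add: T_def card_image inj_on_subset)
  have T_V: "T \<subseteq> configs n" by (auto simp: T_def intro!: unit_config_in_configs)
  \<comment> \<open>The positions of \<open>c\<close> and \<open>f a\<close> are prescribed, so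
    these two points cannot serve as neighbours; \<open>a\<close> is outside the fibre
    anyway.\<close>
  let ?F = "{x \<in> configs n. f x = c} - {c, f a}"
  have "card ?F \<ge> n + 2 - card {c, f a}"
    using fibre diff_card_le_card_Diff[of "{c, f a}" "{x \<in> configs n. f x = c}"] by simp
  then have "card ?F \<ge> n" by (simp add: card_insert_if split: if_splits)
  then obtain Q where Q: "Q \<subseteq> ?F" "card Q = card T"
    unfolding cardT by (meson obtain_subset_with_card_n)
  have finQ: "finite Q" using finite_subset[OF Q(1)] finite_configs by simp
  then obtain r where r: "bij_betw r Q T"
    using finite_same_card_bij[OF finQ _ Q(2)] T_V finite_configs finite_subset by blast
  \<comment> \<open>The position of \<open>c\<close>, with \<open>f a\<close> at its antipode. If
    \<open>c\<close> or \<open>f a\<close> coincides with \<open>a\<close>, it must sit at 0, which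
    fixes the other one. Otherwise \<open>?e 1 + ?e 2\<close> is chosen: for
    \<open>n \<ge> 4\<close> it and its antipode both have weight at least 2 and so avoid 0 and
    \<open>T\<close>.\<close>
  define y where "y = (if c = a then 0 else if f a = a then all_ones n else ?e 1 + ?e 2)"
  define g where "g = r(a := 0, c := y, f a := y + all_ones n)"
  have fa: "f a \<in> configs n" using f a by (auto simp: boolean_network_def)
  have notQ: "a \<notin> Q" "c \<notin> Q" "f a \<notin> Q" using Q a by auto
  have gQ: "g q = r q" if "q \<in> Q" for q using that notQ by (auto simp: g_def)
  have ga: "g a = 0" "g c = y" "g (f a) = y + all_ones n" using a by (auto simp: g_def y_def)
  have yV: "y \<in> configs n" using n
    by (auto simp: y_def intro!: configs_add zero_in_configs all_ones_in_configs unit_config_in_configs)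
  have "?e k \<noteq> 0" for k by (metis unit_config_apply zero_fun_def zero_neq_one)
  then have T0: "0 \<notin> T" by (auto simp: T_def)
  have T_supp: "(t 1 = 0 \<or> t 2 = 0) \<and> (t 3 = 0 \<or> t 4 = 0)" if "t \<in> T" for t
    using that by (auto simp: T_def unit_config_apply)
  have y_ones: "(y + all_ones n) i = y i + 1" if "i \<in> {1..n}" for i
    using that by (simp add: all_ones_apply)
  have y1: "y i = (if c = a then 0 else if f a = a then 1 else if i \<in> {1,2} then 1 else 0)"
    if "i \<in> {1..n}" for i
    using that by (auto simp: y_def all_ones_apply unit_config_apply)
  have y_T: "y \<notin> T"
    using T0 T_supp[of y] y1[of 1] y1[of 2] n by (auto simp: y_def)
  have y'_T: "y + all_ones n \<notin> T"
    using T0 T_supp[of "y + all_ones n"] y1[of 1] y1[of 2] y1[of 3] y1[of 4]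
      y_ones[of 1] y_ones[of 2] y_ones[of 3] y_ones[of 4] n
    by (auto simp: y_def split: if_splits)
  have "all_ones n \<noteq> 0" using all_ones_apply[of 1 n] n by auto
  then have y_y': "y \<noteq> y + all_ones n" by (metis add_cancel_right_right)
  have y_0: "c \<noteq> a \<Longrightarrow> y \<noteq> 0" using y1[of 1] n by (auto split: if_splits)
  have y'_0: "y + all_ones n \<noteq> 0" if "f a \<noteq> a"
  proof
    assume "y + all_ones n = 0"
    then have "(y + all_ones n) 3 = 0" by simp
    then show False using y1[of 3] y_ones[of 3] n that by (auto split: if_splits)
  qed
  show ?thesis
  proof (rule full_digraph_if_placement[OF f, where S = "insert a (insert c (insert (f a) Q))" and g = g])
    show "insert a (insert c (insert (f a) Q)) \<subseteq> configs n" using a c fa Q by auto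
    show "g ` insert a (insert c (insert (f a) Q)) \<subseteq> configs n"
      using r T_V gQ ga yV zero_in_configs configs_add[OF yV all_ones_in_configs] by (auto simp: bij_betw_def)
    have "inj_on g Q" using r gQ by (simp add: bij_betw_def inj_on_def)
    moreover have "g ` Q = T" using r gQ by (simp add: bij_betw_def)
    ultimately show "inj_on g (insert a (insert c (insert (f a) Q)))"
      using T0 y_T y'_T y_y' y_0 y'_0 ga notQ a by (simp add: insert_Diff_if)
  next
    fix i j assume ij: "i \<in> {1..n}" "j \<in> {1..n}"
    have "?e j \<in> T" using ij by (simp add: T_def)
    then obtain q where q: "q \<in> Q" "g q = ?e j" "f q = c"
      using r gQ Q by (force simp: bij_betw_def)
    show "\<exists>p\<in>insert a (insert c (insert (f a) Q)). \<exists>q\<in>insert a (insert c (insert (f a) Q)).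
        f p \<in> insert a (insert c (insert (f a) Q)) \<and> f q \<in> insert a (insert c (insert (f a) Q)) \<and>
        g q = g p + ?e j \<and> g (f p) i \<noteq> g (f q) i"
      using q ij by (intro bexI[of _ a] bexI[of _ q]) (auto simp: ga all_ones_apply)
  qed
qed

section \<open>Networks with many disjoint triples\<close>

text \<open>The triple with index \<open>j\<close> serves direction \<open>j\<close>: its first two
  points are neighbours in that direction, and their images, the last two points, are antipodal. The
  supports \<open>{\<tau> j}\<close>, \<open>{j, \<tau> j}\<close> and the complement of the latter
  achieve this.\<close>

lemma full_digraph_if_disjoint_triples:
  assumes n: "n \<ge> 5" and f: "boolean_network n f"
    and T: "T \<subseteq> configs n" "card T \<ge> n"
    and triple: "\<And>x. x \<in> T \<Longrightarrow> x \<noteq> f x \<and> f x \<noteq> f (f x) \<and> x \<noteq> f (f x)"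
    and disj: "\<And>x y. x \<in> T \<Longrightarrow> y \<in> T \<Longrightarrow> x \<noteq> y \<Longrightarrow> {x, f x, f (f x)} \<inter> {y, f y, f (f y)} = {}"
  shows "full_digraph n \<in> interaction_graphs n f"
proof -
  obtain Q where Q: "Q \<subseteq> T" "card Q = n" using T(2) by (meson obtain_subset_with_card_n)
  have "finite Q" using Q T finite_configs by (meson finite_subset)
  then obtain p where p: "bij_betw p {1..n} Q"
    using finite_same_card_bij[of "{1..n}" Q] Q by auto
  \<comment> \<open>The cyclic successor. It has no cycle of length at most 2, so
    \<open>{j, \<tau> j}\<close> is a genuine pair that determines \<open>j\<close>.\<close>
  define \<tau> where "\<tau> j = (if j = n then 1 else j + 1)" for j
  have \<tau>: "\<tau> j \<in> {1..n}" "\<tau> j \<noteq> j" "\<tau> (\<tau> j) \<noteq> j" if "j \<in> {1..n}" for j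
    using that n by (simp_all add: \<tau>_def)
  have \<tau>_inj: "j = j'" if "\<tau> j = \<tau> j'" "j \<in> {1..n}" "j' \<in> {1..n}" for j j'
    using that n by (cases "j = n"; cases "j' = n") (simp_all add: \<tau>_def)
  define Y where "Y = (\<lambda>(j, k::nat). if k = 0 then {\<tau> j} else if k = 1 then {j, \<tau> j} else {1..n} - {j, \<tau> j})"
  define ind :: "nat set \<Rightarrow> nat \<Rightarrow> bit" where "ind C = (\<lambda>i. if i \<in> C then 1 else 0)" for C
  define X where "X = ind \<circ> Y"
  define P where "P = (\<lambda>(j, k). (f ^^ k) (p j))"
  let ?I = "{1..n} \<times> {0,1,2::nat}"
  have cardY: "card (Y (j, k)) = (if k = 0 then 1 else if k = 1 then 2 else n - 2)" if "j \<in> {1..n}" for j k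
    using \<tau>[OF that] that by (auto simp: Y_def card_Diff_subset)
  have injY: "inj_on Y ?I"
  proof (rule inj_onI)
    fix a b assume ab: "a \<in> ?I" "b \<in> ?I" "Y a = Y b"
    obtain j k j' k' where ab_eq: "a = (j, k)" "b = (j', k')" by fastforce
    have jk: "j \<in> {1..n}" "j' \<in> {1..n}" "k \<in> {0,1,2::nat}" "k' \<in> {0,1,2::nat}"
      and eq: "Y (j, k) = Y (j', k')" using ab unfolding ab_eq by auto
    \<comment> \<open>The support sizes 1, 2 and \<open>n - 2\<close> are pairwise distinct because
      \<open>n \<ge> 5\<close>.\<close>
    have "k = k'"
      using arg_cong[OF eq, of card] jk(3,4) n unfolding cardY[OF jk(1)] cardY[OF jk(2)] by auto
    moreover have "j = j'"
    proof (cases "k = 0")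
      case True
      with eq \<open>k = k'\<close> jk \<tau>_inj show ?thesis by (auto simp: Y_def)
    next
      case False
      have "{j, \<tau> j} = {j', \<tau> j'}"
      proof (cases "k = 1")
        case True
        with eq \<open>k = k'\<close> show ?thesis by (simp add: Y_def)
      next
        case False
        with \<open>k \<noteq> 0\<close> eq \<open>k = k'\<close> have "{1..n} - {j, \<tau> j} = {1..n} - {j', \<tau> j'}"
          by (simp add: Y_def)
        moreover have "{j, \<tau> j} \<subseteq> {1..n}" "{j', \<tau> j'} \<subseteq> {1..n}" using jk \<tau>(1) by auto
        ultimately show ?thesis by (metis double_diff order_refl)
      qed
      then show ?thesis using \<tau>[OF jk(1)] by (metis doubleton_eq_iff)
    qed
    ultimately show "a = b" by (simp add: ab_eq)
  qed
  have injind: "inj ind"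
    by (rule injI) (auto simp: ind_def fun_eq_iff split: if_splits)
  have injX: "inj_on X ?I"
    unfolding X_def using injY injind by (metis comp_inj_on inj_on_subset subset_UNIV)
  have pT: "p j \<in> T" if "j \<in> {1..n}" for j using p Q that by (auto simp: bij_betw_def)
  have P: "P (j, 0) = p j" "P (j, 1) = f (p j)" "P (j, 2) = f (f (p j))" for j
    by (simp_all add: P_def numeral_2_eq_2)
  have injP: "inj_on P ?I"
  proof (rule inj_onI)
    fix a b assume ab: "a \<in> ?I" "b \<in> ?I" "P a = P b"
    obtain j k j' k' where ab_eq: "a = (j, k)" "b = (j', k')" by fastforce
    have jk: "j \<in> {1..n}" "j' \<in> {1..n}" "k \<in> {0,1,2::nat}" "k' \<in> {0,1,2::nat}"
      and eq: "P (j, k) = P (j', k')" using ab unfolding ab_eq by auto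
    have "P (j, k) \<in> {p j, f (p j), f (f (p j))}" "P (j', k') \<in> {p j', f (p j'), f (f (p j'))}"
      using P jk by auto
    with eq have "{p j, f (p j), f (f (p j))} \<inter> {p j', f (p j'), f (f (p j'))} \<noteq> {}"
      by (metis IntI empty_iff)
    then have "p j = p j'" using disj[OF pT[OF jk(1)] pT[OF jk(2)]] by meson
    then have "j = j'" using p jk(1,2) unfolding bij_betw_def by (meson inj_onD)
    moreover from this have "k = k'"
      using triple[OF pT[OF jk(1)]] eq jk(3,4) P[of j] by auto
    ultimately show "a = b" by (simp add: ab_eq)
  qed
  define g where "g = X \<circ> inv_into ?I P"
  have gP: "g (P a) = X a" if "a \<in> ?I" for a using injP that by (simp add: g_def)
  have fV: "f x \<in> configs n" if "x \<in> configs n" for x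
    using f that by (auto simp: boolean_network_def)
  show ?thesis
  proof (rule full_digraph_if_placement[OF f, where S = "P ` ?I" and g = g])
    show "P ` ?I \<subseteq> configs n" using P pT T(1) fV by (auto simp: subset_iff)
    have "inj_on (g \<circ> P) ?I" using injX gP by (subst inj_on_cong[of ?I "g \<circ> P" X]) simp_all
    then show "inj_on g (P ` ?I)" by (rule inj_on_imageI)
    have "X a \<in> configs n" if "a \<in> ?I" for a
      using that \<tau>(1) by (auto simp: X_def ind_def Y_def configs_def)
    then show "g ` P ` ?I \<subseteq> configs n" using gP by fastforce
  next
    fix i j assume ij: "i \<in> {1..n}" "j \<in> {1..n}"
    have X1: "X (j, 1) = X (j, 0) + unit_config j"
    proof
      fix l
      show "X (j, 1) l = (X (j, 0) + unit_config j) l"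
        using \<tau>(2)[OF ij(2)] by (simp add: X_def ind_def Y_def unit_config_apply)
    qed
    have X2: "X (j, 1) i \<noteq> X (j, 2) i" using ij(1) by (simp add: X_def ind_def Y_def)
    have I: "(j, 0) \<in> ?I" "(j, 1) \<in> ?I" "(j, 2) \<in> ?I" using ij(2) by simp_all
    have f_P: "f (P (j, 0)) = P (j, 1)" "f (P (j, 1)) = P (j, 2)" by (simp_all only: P)
    have "f (P (j, 0)) \<in> P ` ?I" "f (P (j, 1)) \<in> P ` ?I"
      unfolding f_P using I by (blast intro: imageI)+
    moreover have "g (P (j, 1)) = g (P (j, 0)) + unit_config j" unfolding gP[OF I(1)] gP[OF I(2)] by (rule X1)
    moreover have "g (f (P (j, 0))) i \<noteq> g (f (P (j, 1))) i"
      unfolding f_P gP[OF I(2)] gP[OF I(3)] by (rule X2)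
    ultimately show "\<exists>x\<in>P ` ?I. \<exists>y\<in>P ` ?I. f x \<in> P ` ?I \<and> f y \<in> P ` ?I \<and>
        g y = g x + unit_config j \<and> g (f x) i \<noteq> g (f y) i"
      using imageI[OF I(1), of P] imageI[OF I(2), of P] by blast
  qed
qed

section \<open>Extracting an independent set and disjoint triples\<close>

text \<open>
  Induction: a point outside \<open>f ` P\<close> can be put into \<open>A\<close> and removed together with its image;
  if there is none, \<open>f\<close> permutes \<open>P\<close> and the middle point \<open>f x\<close> of a removed triple goes into \<open>A\<close>.
\<close>

lemma independent_set_and_triples:
  fixes f :: "'a \<Rightarrow> 'a"
  assumes "finite P" "\<forall>x\<in>P. f x \<noteq> x"
  shows "\<exists>A T. A \<subseteq> P \<and> f ` A \<inter> A = {} \<and> T \<subseteq> P \<and> card P \<le> 2 * card A + card T \<and>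
    (\<forall>x\<in>T. {x, f x, f (f x)} \<subseteq> P \<and> x \<noteq> f x \<and> f x \<noteq> f (f x) \<and> x \<noteq> f (f x)) \<and>
    (\<forall>x\<in>T. \<forall>y\<in>T. x \<noteq> y \<longrightarrow> {x, f x, f (f x)} \<inter> {y, f y, f (f y)} = {})"
  using assms
proof (induction "card P" arbitrary: P rule: less_induct)
  case less
  \<comment> \<open>The induction hypothesis for \<open>P - R\<close>, with the loss
    \<open>card R\<close> added to the count. \<open>R\<close> need only meet \<open>P\<close>,
    since \<open>f x\<close> may lie outside \<open>P\<close> when \<open>R\<close> is
    \<open>{x, f x}\<close>.\<close>
  have drop: "\<exists>A T. A \<subseteq> P - R \<and> f ` A \<inter> A = {} \<and> T \<subseteq> P - R \<and> card P \<le> 2 * card A + card T + card R \<and>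
    (\<forall>x\<in>T. {x, f x, f (f x)} \<subseteq> P - R \<and> x \<noteq> f x \<and> f x \<noteq> f (f x) \<and> x \<noteq> f (f x)) \<and>
    (\<forall>x\<in>T. \<forall>y\<in>T. x \<noteq> y \<longrightarrow> {x, f x, f (f x)} \<inter> {y, f y, f (f y)} = {})"
    if "P \<inter> R \<noteq> {}" "finite R" for R
  proof -
    have lt: "card (P - R) < card P" using that less.prems(1) by (intro psubset_card_mono) auto
    have "card P \<le> card (P - R) + card R"
      using diff_card_le_card_Diff[OF that(2), of P] by simp
    moreover have nofix: "\<forall>x\<in>P - R. f x \<noteq> x" using less.prems(2) by simp
    obtain A T where "A \<subseteq> P - R" "f ` A \<inter> A = {}" "T \<subseteq> P - R" "card (P - R) \<le> 2 * card A + card T"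
      "\<forall>x\<in>T. {x, f x, f (f x)} \<subseteq> P - R \<and> x \<noteq> f x \<and> f x \<noteq> f (f x) \<and> x \<noteq> f (f x)"
      "\<forall>x\<in>T. \<forall>y\<in>T. x \<noteq> y \<longrightarrow> {x, f x, f (f x)} \<inter> {y, f y, f (f y)} = {}"
      using less.hyps[OF lt finite_Diff[OF less.prems(1)] nofix] by (elim exE conjE)
    ultimately show ?thesis by (intro exI[of _ A] exI[of _ T] conjI) simp_all
  qed
  consider "P = {}" | x where "x \<in> P" "x \<notin> f ` P"
    | x where "x \<in> P" "P \<subseteq> f ` P" by blast
  then show ?case
  proof cases
    case 1
    then show ?thesis by auto
  next
    case 2
    have "P \<inter> {x, f x} \<noteq> {}" "finite {x, f x}" using 2 by auto
    from drop[OF this] obtain A T where AT: "A \<subseteq> P - {x, f x}" "f ` A \<inter> A = {}" "T \<subseteq> P - {x, f x}"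
      "card P \<le> 2 * card A + card T + card {x, f x}"
      "\<forall>x'\<in>T. {x', f x', f (f x')} \<subseteq> P - {x, f x} \<and> x' \<noteq> f x' \<and> f x' \<noteq> f (f x') \<and> x' \<noteq> f (f x')"
      "\<forall>x\<in>T. \<forall>y\<in>T. x \<noteq> y \<longrightarrow> {x, f x, f (f x)} \<inter> {y, f y, f (f y)} = {}"
      by (elim exE conjE) 
    have "finite A" using AT(1) less.prems(1) by (meson finite_Diff finite_subset)
    moreover have "card {x, f x} = 2" using less.prems(2) 2(1) by auto
    ultimately have "card P \<le> 2 * card (insert x A) + card T"
      using AT(1,4) by (subst card_insert_disjoint) auto
    moreover have "f ` insert x A \<inter> insert x A = {}"
      using AT(1,2) 2 less.prems(2) 2(1) by auto
    moreover have "insert x A \<subseteq> P" "T \<subseteq> P"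
      "\<forall>x\<in>T. {x, f x, f (f x)} \<subseteq> P \<and> x \<noteq> f x \<and> f x \<noteq> f (f x) \<and> x \<noteq> f (f x)"
      using AT 2 by auto
    ultimately show ?thesis using AT(6) by (intro exI[of _ "insert x A"] exI[of _ T] conjI)
  next
    case 3
    have "card (f ` P) \<le> card P" using less.prems(1) by (rule card_image_le)
    with 3(2) have fP: "f ` P = P" using less.prems(1) by (metis card_seteq finite_imageI)
    then have inj: "inj_on f P" using less.prems(1) by (simp add: eq_card_imp_inj_on)
    have P3: "f x \<in> P" "f (f x) \<in> P" using 3(1) fP by auto
    have ne: "f x \<noteq> x" "f (f x) \<noteq> f x" using less.prems(2) 3(1) P3(1) by auto
    let ?R = "{x, f x, f (f x)}"
    have "P \<inter> ?R \<noteq> {}" "finite ?R" using 3 by auto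
    from drop[OF this] obtain A T where AT: "A \<subseteq> P - ?R" "f ` A \<inter> A = {}" "T \<subseteq> P - ?R"
      "card P \<le> 2 * card A + card T + card ?R"
      "\<forall>x\<in>T. {x, f x, f (f x)} \<subseteq> P - ?R \<and> x \<noteq> f x \<and> f x \<noteq> f (f x) \<and> x \<noteq> f (f x)"
      "\<forall>x\<in>T. \<forall>y\<in>T. x \<noteq> y \<longrightarrow> {x, f x, f (f x)} \<inter> {y, f y, f (f y)} = {}"
      by (elim exE conjE) 
    have fin: "finite A" "finite T" using AT(1,3) less.prems(1) by (meson finite_Diff finite_subset)+
    \<comment> \<open>By injectivity only \<open>x\<close> maps to \<open>f x\<close> within
      \<open>P\<close>, and \<open>A\<close> avoids both \<open>x\<close> and
      \<open>f (f x)\<close>.\<close>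
    have A': "f ` insert (f x) A \<inter> insert (f x) A = {}" "insert (f x) A \<subseteq> P"
      using AT(1,2) ne inj P3 3(1) by (auto simp: inj_on_def)
    have cA: "card (insert (f x) A) = card A + 1" using fin AT(1) by (subst card_insert_disjoint) auto
    show ?thesis
    \<comment> \<open>The count pays 2 for a point of \<open>A\<close> and 1 for a triple. A 2-cycle
      removes two points, paid for by \<open>f x\<close> alone; otherwise three points go, and the
      triple of \<open>x\<close> pays for the third.\<close>
    proof (cases "f (f x) = x")
      case True
      then have "card ?R \<le> 2" using ne by (simp add: card_insert_if)
      then have "card P \<le> 2 * card (insert (f x) A) + card T" using AT(4) cA by simp
      moreover have "T \<subseteq> P"
        "\<forall>x\<in>T. {x, f x, f (f x)} \<subseteq> P \<and> x \<noteq> f x \<and> f x \<noteq> f (f x) \<and> x \<noteq> f (f x)"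
        using AT(3,5) by blast+
      ultimately show ?thesis using A' AT(6)
        by (intro exI[of _ "insert (f x) A"] exI[of _ T] conjI)
    next
      case False
      have "card ?R \<le> 3" using ne by (simp add: card_insert_if)
      moreover have "card (insert x T) = card T + 1" using fin AT(3) by (subst card_insert_disjoint) auto
      ultimately have "card P \<le> 2 * card (insert (f x) A) + card (insert x T)" using AT(4) cA by simp
      moreover have "\<forall>y\<in>insert x T. {y, f y, f (f y)} \<subseteq> P \<and> y \<noteq> f y \<and> f y \<noteq> f (f y) \<and> y \<noteq> f (f y)"
        using AT(5) P3 ne False 3(1) by auto
      moreover have "\<forall>y\<in>insert x T. \<forall>z\<in>insert x T. y \<noteq> z \<longrightarrow> {y, f y, f (f y)} \<inter> {z, f z, f (f z)} = {}"
      proof -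
        have "?R \<inter> {y, f y, f (f y)} = {}" if "y \<in> T" for y using AT(5) that by blast
        then show ?thesis using AT(6) by (metis Int_commute insert_iff)
      qed
      moreover have "insert x T \<subseteq> P" using AT(3) 3(1) by auto
      ultimately show ?thesis using A' by (intro exI[of _ "insert (f x) A"] exI[of _ "insert x T"] conjI)
    qed
  qed
qed

section \<open>Trees and forests with distinct edge directions\<close>

text \<open>
  The tree grows by one leaf per direction: the new leaf is the only point with a nonzero
  coordinate in the fresh direction.
\<close>

lemma tree_placement:
  fixes X Y :: "'a set" and J :: "nat set"
  assumes "finite X" "finite Y" "X \<noteq> {}" "Y \<noteq> {}" "X \<inter> Y = {}" "finite J"
    and "card X + card Y = card J + 1"
  shows "\<exists>\<rho>. inj_on \<rho> (X \<union> Y) \<and> (\<forall>r\<in>X \<union> Y. \<forall>i. i \<notin> J \<longrightarrow> \<rho> r i = 0) \<and>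
    (\<forall>j\<in>J. \<exists>p\<in>X. \<exists>q\<in>Y. \<rho> q = \<rho> p + unit_config j)"
  using assms
proof (induction "card J" arbitrary: X Y J)
  case 0
  then have "card X > 0" "card Y > 0" by (simp_all add: card_gt_0_iff)
  with 0 show ?case by simp
next
  case (Suc m)
  have grow: "\<exists>\<rho>. inj_on \<rho> (X \<union> Y) \<and> (\<forall>r\<in>X \<union> Y. \<forall>i. i \<notin> J \<longrightarrow> \<rho> r i = 0) \<and>
    (\<forall>j\<in>J. \<exists>p\<in>X. \<exists>q\<in>Y. \<rho> q = \<rho> p + unit_config j)"
    if XY: "finite X" "finite Y" "Y \<noteq> {}" "X \<inter> Y = {}" "card X + card Y = card J + 1" "card X \<ge> 2"
    for X Y :: "'a set"
  proof -
    \<comment> \<open>\<open>p\<close> becomes the new leaf, attached to \<open>q\<close> by an edge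
      in the direction \<open>j\<close> withheld from the smaller tree. The choices are arbitrary;
      \<open>card X \<ge> 2\<close> keeps the colour class of \<open>p\<close> nonempty.\<close>
    obtain p j q where pjq: "p \<in> X" "j \<in> J" "q \<in> Y"
      using XY Suc.hyps(2) by (metis all_not_in_conv card.empty not_numeral_le_zero nat.distinct(1))
    have "card (X - {p}) = card X - 1" using pjq by simp
    then have "X - {p} \<noteq> {}" using XY(6) by (metis card.empty diff_is_0_eq not_less_eq_eq numeral_2_eq_2 One_nat_def)
    then have "\<exists>\<rho>. inj_on \<rho> (X - {p} \<union> Y) \<and> (\<forall>r\<in>X - {p} \<union> Y. \<forall>i. i \<notin> J - {j} \<longrightarrow> \<rho> r i = 0) \<and>
        (\<forall>k\<in>J - {j}. \<exists>p'\<in>X - {p}. \<exists>q\<in>Y. \<rho> q = \<rho> p' + unit_config k)"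
      using Suc.hyps(2) Suc.prems(6) XY pjq by (intro Suc.hyps(1)) auto
    then obtain \<rho> where \<rho>: "inj_on \<rho> (X - {p} \<union> Y)" 
      "\<forall>r\<in>X - {p} \<union> Y. \<forall>i. i \<notin> J - {j} \<longrightarrow> \<rho> r i = 0"
      and \<rho>_edge: "\<forall>k\<in>J - {j}. \<exists>p'\<in>X - {p}. \<exists>q\<in>Y. \<rho> q = \<rho> p' + unit_config k"
      by (elim exE conjE)
    have \<rho>_0: "\<rho> r i = 0" if "r \<in> X - {p} \<union> Y" "i \<notin> J - {j}" for r i
      using \<rho>(2) that by blast
    define \<rho>' where "\<rho>' = \<rho>(p := \<rho> q + unit_config j)"
    have pY: "p \<notin> Y" using XY pjq by auto
    have "\<rho>' p j = 1" using \<rho>_0[of q j] pjq by (simp add: \<rho>'_def unit_config_apply)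
    then have "\<rho>' p \<noteq> \<rho> r" if "r \<in> X - {p} \<union> Y" for r using \<rho>_0[OF that, of j] by auto
    then have "\<rho>' p \<notin> \<rho>' ` (X - {p} \<union> Y)" using pY by (auto simp: \<rho>'_def)
    moreover have "inj_on \<rho>' (X - {p} \<union> Y)" using \<rho>(1) pY by (auto simp: \<rho>'_def inj_on_def)
    moreover have "X \<union> Y = insert p (X - {p} \<union> Y)" using pjq by auto
    ultimately have "inj_on \<rho>' (X \<union> Y)" using pY by (simp add: inj_on_insert)
    moreover have "\<rho>' r i = 0" if "r \<in> X \<union> Y" "i \<notin> J" for r i
      using that \<rho>_0[of r i] \<rho>_0[of q i] pjq by (auto simp: \<rho>'_def unit_config_apply)
    moreover have "\<exists>p\<in>X. \<exists>q\<in>Y. \<rho>' q = \<rho>' p + unit_config k" if k: "k \<in> J" for k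
    proof (cases "k = j")
      case True
      have "\<rho>' q = \<rho>' p + unit_config j" using pjq pY by (auto simp: \<rho>'_def add.assoc)
      then show ?thesis using True pjq by blast
    next
      case False
      then obtain p' q' where "p' \<in> X - {p}" "q' \<in> Y" "\<rho> q' = \<rho> p' + unit_config k" using k \<rho>_edge by blast
      then show ?thesis using pY by (intro bexI[of _ p'] bexI[of _ q']) (auto simp: \<rho>'_def)
    qed
    ultimately show ?thesis by (intro exI[of _ \<rho>']) blast
  qed
  have pos: "card X > 0" "card Y > 0" using Suc.prems by (simp_all add: card_gt_0_iff)
  consider "card X \<ge> 2" | "card Y \<ge> 2" | "card X = 1" "card Y = 1" using pos by linarith
  then show ?case
  proof cases
    case 1
    then show ?thesis using grow[of X Y] Suc.prems by blast
  next
    case 2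
    have "Y \<inter> X = {}" "card Y + card X = card J + 1" using Suc.prems by auto
    then obtain \<rho> where "inj_on \<rho> (Y \<union> X)" "\<forall>r\<in>Y \<union> X. \<forall>i. i \<notin> J \<longrightarrow> \<rho> r i = 0"
      "\<forall>j\<in>J. \<exists>p\<in>Y. \<exists>q\<in>X. \<rho> q = \<rho> p + unit_config j"
      using grow[of Y X] 2 Suc.prems by blast
    then show ?thesis
      by (intro exI[of _ \<rho>]) (metis Un_commute config_add_eq_iff)
  next
    case 3
    then obtain p q where pq: "X = {p}" "Y = {q}" by (meson card_1_singletonE)
    have "card J = 1" using Suc.prems(7) 3 by simp
    then obtain j where "J = {j}" by (meson card_1_singletonE)
    with pq Suc.prems(5) show ?thesis
      by (intro exI[of _ "\<lambda>r. if r = p then 0 else unit_config j"])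
        (auto simp: unit_config_apply fun_eq_iff)
  qed
qed

text \<open>A shift is bad only if it equals \<open>u + d\<close> for some \<open>u\<close> in
  \<open>U\<close> and \<open>d\<close> in \<open>D\<close>, and there are too few such sums to fill
  the cube.\<close>

lemma translate_avoiding:
  assumes "finite D" "finite U" "card D * card U < 2 ^ n"
  obtains x where "x \<in> configs n" "\<And>d. d \<in> D \<Longrightarrow> d + x \<notin> U"
proof -
  let ?B = "(\<lambda>(d, u). u + d) ` (D \<times> U)"
  have "card ?B \<le> card D * card U"
    using card_image_le[of "D \<times> U"] assms by (simp add: card_cartesian_product)
  then have "card ?B < card (configs n)" using assms(3) by (simp add: card_configs)
  then have "\<not> configs n \<subseteq> ?B" using card_mono[of ?B "configs n"] assms by auto
  then obtain x where x: "x \<in> configs n" "x \<notin> ?B" by blast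
  have "d + x \<notin> U" if "d \<in> D" for d
  proof
    assume "d + x \<in> U"
    then have "(\<lambda>(d, u). u + d) (d, d + x) \<in> ?B" using that by blast
    then show False using x(2) by (simp add: add.commute add.left_commute)
  qed
  then show thesis using that x(1) by blast
qed

lemma square_less_power2: "n \<ge> 5 \<Longrightarrow> n * n < (2 :: nat) ^ n"
proof (induction n rule: dec_induct)
  case (step n)
  have "2 * n + 1 \<le> n * n" using step(1) mult_le_mono1[of 5 n n] by linarith
  then have "Suc n * Suc n \<le> 2 * (n * n)" by simp
  also have "\<dots> < 2 * 2 ^ n" using step(3) by (rule mult_strict_left_mono) simp
  finally show ?case by simp
qed simp

text \<open>
  The map \<open>\<tau>\<close> records which fibres are paired: the images with labels \<open>(k, True)\<close> and \<open>(k, False)\<close>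
  are later placed antipodally.
\<close>

lemma forest_placement:
  fixes f :: "'a \<Rightarrow> 'b"
  assumes n: "n \<ge> 5"
    and "finite A" "card (f ` A) = 2 * r" "J \<subseteq> {1..n}" "card J + r = card A" "card A \<le> 2 * n"
  shows "\<exists>\<rho> \<tau>. inj_on \<rho> A \<and> \<rho> ` A \<subseteq> configs n \<and> inj_on \<tau> (f ` A) \<and> \<tau> ` f ` A \<subseteq> {..<r} \<times> UNIV \<and>
    (\<forall>j\<in>J. \<exists>p\<in>A. \<exists>q\<in>A. \<exists>k. \<rho> q = \<rho> p + unit_config j \<and> \<tau> (f p) = (k, True) \<and> \<tau> (f q) = (k, False))"
  using assms(2-)
\<comment> \<open>The equation \<open>card J + r = card A\<close> is the edge count of a forest with
  \<open>r\<close> trees. Each step splits off the tree on two fibres \<open>U\<close> and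
  \<open>W\<close>.\<close>
proof (induction r arbitrary: A J)
  case 0
  then have "A = {}" by simp
  moreover from this 0 have "J = {}" using finite_subset by fastforce
  ultimately show ?case by simp
next
  case (Suc r)
  have "2 \<le> card (f ` A)" using Suc.prems(2) by simp
  then obtain c d where cd: "c \<in> f ` A" "d \<in> f ` A" "c \<noteq> d"
    by (metis insert_subset obtain_subset_with_card_n card_2_iff)
  define U W A' where "U = {x \<in> A. f x = c}" and "W = {x \<in> A. f x = d}" and "A' = A - (U \<union> W)"
  have fin: "finite U" "finite W" "finite A'" using Suc.prems(1) by (auto simp: U_def W_def A'_def)
  have ne: "U \<noteq> {}" "W \<noteq> {}" "U \<inter> W = {}" using cd by (auto simp: U_def W_def)
  have pos: "card U > 0" "card W > 0" using fin ne by (simp_all add: card_gt_0_iff)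
  have A: "A = (U \<union> W) \<union> A'" "(U \<union> W) \<inter> A' = {}" by (auto simp: U_def W_def A'_def)
  have cA: "card A = card U + card W + card A'"
    using A fin ne by (metis card_Un_disjoint finite_UnI)
  have fA': "f ` A' = f ` A - {c, d}" by (auto simp: A'_def U_def W_def)
  then have cfA': "card (f ` A') = 2 * r" using Suc.prems(2) cd Suc.prems(1) by (simp add: card_Diff_subset)
  \<comment> \<open>Every remaining image has a preimage in \<open>A'\<close>. Hence
    \<open>J\<close> contains enough directions for the \<open>card U + card W - 1\<close> edges of
    the new tree.\<close>
  have "2 * r \<le> card A'" using card_image_le[OF fin(3), of f] cfA' by simp
  then have cUW: "card U + card W - 1 \<le> card J" using cA Suc.prems(4) by linarith
  then obtain J1 where J1: "J1 \<subseteq> J" "card J1 = card U + card W - 1"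
    by (meson obtain_subset_with_card_n)
  have finJ: "finite J" "finite J1" using Suc.prems(3) J1 by (meson finite_atLeastAtMost finite_subset)+
  have cJ: "card (J - J1) + r = card A'"
    using J1 finJ cA cUW Suc.prems(4) pos by (simp add: card_Diff_subset)
  have "\<exists>\<rho>. inj_on \<rho> (U \<union> W) \<and> (\<forall>r\<in>U \<union> W. \<forall>i. i \<notin> J1 \<longrightarrow> \<rho> r i = 0) \<and>
    (\<forall>j\<in>J1. \<exists>p\<in>U. \<exists>q\<in>W. \<rho> q = \<rho> p + unit_config j)"
    using fin ne finJ J1 pos by (intro tree_placement) auto
  then obtain \<rho>1 where \<rho>1: "inj_on \<rho>1 (U \<union> W)" "\<And>r i. r \<in> U \<union> W \<Longrightarrow> i \<notin> J1 \<Longrightarrow> \<rho>1 r i = 0"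
    "\<And>j. j \<in> J1 \<Longrightarrow> \<exists>p\<in>U. \<exists>q\<in>W. \<rho>1 q = \<rho>1 p + unit_config j"
    by blast
  have \<rho>1V: "\<rho>1 x \<in> configs n" if "x \<in> U \<union> W" for x
    using \<rho>1(2)[OF that] J1(1) Suc.prems(3) by (fastforce simp: configs_def)
  have "J - J1 \<subseteq> {1..n}" "card A' \<le> 2 * n" using Suc.prems(3,5) cA by auto
  from Suc.IH[OF fin(3) cfA' this(1) cJ this(2)] obtain \<rho>2 \<tau>2 where \<rho>2: "inj_on \<rho>2 A'" "\<rho>2 ` A' \<subseteq> configs n" "inj_on \<tau>2 (f ` A')" "\<tau>2 ` f ` A' \<subseteq> {..<r} \<times> UNIV"
    "\<forall>j\<in>J - J1. \<exists>p\<in>A'. \<exists>q\<in>A'. \<exists>k. \<rho>2 q = \<rho>2 p + unit_config j \<and>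
       \<tau>2 (f p) = (k, True) \<and> \<tau>2 (f q) = (k, False)"
    by (elim exE conjE)
  \<comment> \<open>Two sizes with sum at most \<open>2 * n\<close> have product at most
    \<open>n * n\<close>, which is below \<open>2 ^ n\<close>. So the new tree can be translated off
    the old forest, and translation preserves edge directions.\<close>
  have "card (\<rho>1 ` (U \<union> W)) * card (\<rho>2 ` A') < 2 ^ n"
  proof -
    define a b where "a = card (\<rho>1 ` (U \<union> W))" and "b = card (\<rho>2 ` A')"
    have "a \<le> card U + card W" unfolding a_def using \<rho>1(1) card_Un_le by (simp add: card_image)
    moreover have "b = card A'" unfolding b_def using \<rho>2(1) by (simp add: card_image)
    ultimately have "a + b \<le> 2 * n" using cA Suc.prems(5) by linarith
    then have "a * b \<le> n * n"
    proof -
      have "(int a - int b)\<^sup>2 \<ge> 0" by simp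
      then have "4 * (int a * int b) \<le> (int a + int b)\<^sup>2" by (simp add: power2_eq_square algebra_simps)
      also have "\<dots> \<le> (2 * int n)\<^sup>2" using \<open>a + b \<le> 2 * n\<close> by (intro power_mono) auto
      finally have "int (a * b) \<le> int (n * n)" by (simp add: power2_eq_square)
      then show ?thesis by (simp only: of_nat_le_iff)
    qed
    also have "\<dots> < 2 ^ n" using n by (rule square_less_power2)
    finally show ?thesis by (simp add: a_def b_def)
  qed
  then obtain x where x: "x \<in> configs n" "\<And>v. v \<in> \<rho>1 ` (U \<union> W) \<Longrightarrow> v + x \<notin> \<rho>2 ` A'"
    using translate_avoiding[of "\<rho>1 ` (U \<union> W)" "\<rho>2 ` A'" n] fin by auto
  define \<rho> where "\<rho> v = (if v \<in> U \<union> W then \<rho>1 v + x else \<rho>2 v)" for v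
  define \<tau> where "\<tau> = \<tau>2(c := (r, True), d := (r, False))"
  have \<rho>_1: "\<rho> v = \<rho>1 v + x" if "v \<in> U \<union> W" for v using that by (simp add: \<rho>_def)
  have \<rho>_2: "\<rho> v = \<rho>2 v" if "v \<in> A'" for v using that A(2) by (auto simp: \<rho>_def)
  have \<tau>_2: "\<tau> b = \<tau>2 b" if "b \<in> f ` A'" for b using that fA' by (auto simp: \<tau>_def)
  have \<tau>_inj: "inj_on \<tau> (f ` A')" using \<rho>2(3) \<tau>_2 by (simp add: inj_on_def)
  have "\<tau> ` f ` A' = \<tau>2 ` f ` A'" using \<tau>_2 by (intro image_cong) auto
  then have \<tau>_img: "\<tau> ` f ` A' \<subseteq> {..<r} \<times> UNIV" using \<rho>2(4) by simp
  have \<tau>_cd: "\<tau> c = (r, True)" "\<tau> d = (r, False)" using cd by (auto simp: \<tau>_def)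
  have fA: "f ` A = insert c (insert d (f ` A'))" using fA' cd by auto
  have "inj_on \<rho> (U \<union> W)" using \<rho>1(1) \<rho>_1 by (simp add: inj_on_def)
  moreover have "inj_on \<rho> A'" using \<rho>2(1) \<rho>_2 by (simp add: inj_on_def)
  moreover have "\<rho> ` (U \<union> W) \<inter> \<rho> ` A' = {}" using x(2) \<rho>_1 \<rho>_2 by fastforce
  ultimately have "inj_on \<rho> A" by (subst A(1), intro inj_on_Un[THEN iffD2]) blast
  moreover have "\<rho> ` A \<subseteq> configs n"
    using \<rho>_1 \<rho>_2 configs_add[OF \<rho>1V x(1)] \<rho>2(2) by (subst A(1)) auto
  moreover have "inj_on \<tau> (f ` A)" unfolding fA
    using \<tau>_img \<tau>_inj \<tau>_cd by (fastforce simp: inj_on_insert)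
  moreover have "\<tau> ` f ` A \<subseteq> {..<Suc r} \<times> UNIV" unfolding fA
    using \<tau>_img \<tau>_cd by fastforce
  moreover have "\<forall>j\<in>J. \<exists>p\<in>A. \<exists>q\<in>A. \<exists>k. \<rho> q = \<rho> p + unit_config j \<and> \<tau> (f p) = (k, True) \<and> \<tau> (f q) = (k, False)"
  proof
    fix j assume j: "j \<in> J"
    show "\<exists>p\<in>A. \<exists>q\<in>A. \<exists>k. \<rho> q = \<rho> p + unit_config j \<and> \<tau> (f p) = (k, True) \<and> \<tau> (f q) = (k, False)"
    proof (cases "j \<in> J1")
    case True
    then obtain p q where pq: "p \<in> U" "q \<in> W" "\<rho>1 q = \<rho>1 p + unit_config j" using \<rho>1(3) by blast
    then have "\<rho> q = \<rho> p + unit_config j" using \<rho>_1 by (simp add: ac_simps)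
    moreover have "f p = c" "f q = d" "p \<in> A" "q \<in> A" using pq by (auto simp: U_def W_def)
    ultimately show ?thesis using \<tau>_cd by (intro bexI[of _ p] bexI[of _ q]) auto
  next
    case False
    then obtain p q k where "p \<in> A'" "q \<in> A'" "\<rho>2 q = \<rho>2 p + unit_config j"
      "\<tau>2 (f p) = (k, True)" "\<tau>2 (f q) = (k, False)" using \<rho>2(5) j by blast
    then show ?thesis using \<rho>_2 \<tau>_2 A(1)
      by (intro bexI[of _ p] bexI[of _ q] exI[of _ k]) auto
    qed
  qed
  ultimately show ?case by (intro exI[of _ \<rho>] exI[of _ \<tau>] conjI)
qed

section \<open>Balancing the fibres\<close>

text \<open>This provides the input of \<open>forest_placement\<close>: \<open>n + r\<close> points
  in \<open>r\<close> pairs of fibres span a forest with exactly \<open>n\<close> edges, one per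
  direction.\<close>

lemma even_image_subset:
  fixes f :: "'a \<Rightarrow> 'b"
  assumes "finite A" "card A = 2 * n" "n \<ge> 1"
    and fibre: "\<And>c. card {x \<in> A. f x = c} < 2 * n"
  shows "\<exists>A1\<subseteq>A. \<exists>r. card (f ` A1) = 2 * r \<and> card A1 = n + r"
proof -
  \<comment> \<open>Keep one point per image and add others of \<open>B\<close> until the size is
    \<open>n + r\<close>; no image is lost.\<close>
  have shrink: "\<exists>A1\<subseteq>A. card (f ` A1) = 2 * r \<and> card A1 = n + r"
    if B: "B \<subseteq> A" "card (f ` B) = 2 * r" "r \<le> n" "n + r \<le> card B" for B r
  proof -
    obtain R where R: "R \<subseteq> B" "inj_on f R" "f ` B = f ` R"
      using subset_image_inj[of "f ` B" f B] by auto
    have "card R = 2 * r" using card_image[OF R(2)] R(3) B(2) by simp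
    moreover have "finite B" using B(1) assms(1) finite_subset by blast
    ultimately obtain A1 where A1: "R \<subseteq> A1" "A1 \<subseteq> B" "card A1 = n + r"
      using exists_subset_between[of R "n + r" B] B R(1) by auto
    have "f ` A1 = f ` B" using A1 R(3) by blast
    then show ?thesis using A1 B by (intro exI[of _ A1]) auto
  qed
  define m where "m = card (f ` A)"
  have m_le: "m \<le> 2 * n" using card_image_le[OF assms(1), of f] assms(2) by (simp add: m_def)
  show ?thesis
  proof (cases "even m")
    case True
    then obtain r where "m = 2 * r" by blast
    then show ?thesis using shrink[of A r] m_le assms(2) by (auto simp: m_def)
  next
    case False
    then have m0: "m \<noteq> 0" by (metis even_zero)
    have "m \<noteq> 1"
    proof
      assume "m = 1"
      then obtain c where "f ` A = {c}" unfolding m_def by (meson card_1_singletonE)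
      then have "{x \<in> A. f x = c} = A" by auto
      then show False using fibre[of c] assms(2) by simp
    qed
    with False have m3: "m \<ge> 3" using m0 by (cases "m = 2") auto
    define s where "s c = card {x \<in> A. f x = c}" for c
    have "Min (s ` f ` A) \<in> s ` f ` A"
      using m0 assms(1) by (intro Min_in) (auto simp: m_def)
    then obtain c where c: "c \<in> f ` A" "s c = Min (s ` f ` A)" by (metis imageE)
    have "s c \<le> s d" if "d \<in> f ` A" for d
      using that assms(1) unfolding c(2) by (intro Min_le) auto
    then have "m * s c \<le> (\<Sum>d\<in>f ` A. s d)"
      using sum_bounded_below[of "f ` A" "s c" s] by (simp add: m_def)
    also have "\<dots> = card A"
      using sum.image_gen[OF assms(1), of "\<lambda>_. 1::nat" f] by (simp add: s_def)
    finally have ms: "m * s c \<le> 2 * n" using assms(2) by simp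
    have "{x \<in> A. f x = c} \<noteq> {}" using c(1) by auto
    then have s1: "s c \<ge> 1" using assms(1) by (simp add: s_def Suc_le_eq card_gt_0_iff)
    \<comment> \<open>This says that after discarding the smallest fibre at least
      \<open>n + r\<close> points remain, where \<open>m = 2 * r + 1\<close>. If
      \<open>s c = 1\<close>, it follows from \<open>m\<close> being odd and at most
      \<open>2 * n\<close>. Otherwise \<open>(m - 2) * (s c - 1) \<ge> 1\<close> gives
      \<open>2 * s c + m \<le> m * s c + 1\<close>, and the average fibre size bounds
      \<open>m * s c\<close> by \<open>2 * n\<close>.\<close>
    have key: "2 * s c + m \<le> 2 * n + 1"
    proof (cases "s c = 1")
      case True
      have "m \<noteq> 2 * n" using False by auto
      then show ?thesis using True m_le by simp
    next
      case s2: False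
      obtain a b where ab: "s c = a + 2" "m = b + 3"
        using s1 s2 m3 by (metis One_nat_def Suc_1 add.commute le_Suc_ex le_antisym not_less_eq_eq)
      have "2 * s c + m \<le> m * s c + 1" by (simp add: ab algebra_simps)
      with ms show ?thesis by linarith
    qed
    define B where "B = A - {x \<in> A. f x = c}"
    have "f ` B = f ` A - {c}" by (auto simp: B_def)
    then have fB: "card (f ` B) = m - 1" using c(1) by (simp add: m_def)
    have cB: "card B = 2 * n - s c"
      unfolding B_def using assms(1,2) by (subst card_Diff_subset) (auto simp: s_def)
    obtain r where r: "m = 2 * r + 1" using False by (elim oddE)
    have "B \<subseteq> A" by (auto simp: B_def)
    moreover have "card (f ` B) = 2 * r" using fB r by simp
    moreover have "r \<le> n" "n + r \<le> card B" using key r cB s1 by linarith+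
    ultimately show ?thesis using shrink[of B r] by blast
  qed
qed

section \<open>Antipodal images and the independent case\<close>

text \<open>Each antipodal pair is represented by its member with first coordinate 0. There are at
  least \<open>2 ^ (n - 1)\<close> representatives, and each point of \<open>R\<close> blocks only
  its own pair.\<close>

lemma free_antipodal_pairs:
  assumes n: "n \<ge> 5" and R: "finite R" "card R + r \<le> 2 ^ (n - 1)"
  obtains y where "inj_on y {..<r}" "\<And>k. k < r \<Longrightarrow> y k \<in> configs n" "\<And>k. k < r \<Longrightarrow> y k 1 = 0"
    "\<And>k. k < r \<Longrightarrow> y k \<notin> R" "\<And>k. k < r \<Longrightarrow> y k + all_ones n \<notin> R"
proof -
  let ?o = "all_ones n"
  have o1: "?o 1 = 1" using n by (simp add: all_ones_apply)
  define H0 where "H0 = {x \<in> configs n. x 1 = 0}"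
  have finH0: "finite H0" using finite_configs by (simp add: H0_def)
  have "x \<in> H0 \<union> (\<lambda>x. x + ?o) ` H0" if x: "x \<in> configs n" for x
  proof (cases "x 1 = 0")
    case False
    then have "x + ?o \<in> H0" using x o1 configs_add[OF x all_ones_in_configs] by (simp add: H0_def)
    moreover have "x = (x + ?o) + ?o" by (simp add: add.assoc)
    ultimately show ?thesis by blast
  qed (use x in \<open>simp add: H0_def\<close>)
  then have "card (configs n) \<le> card (H0 \<union> (\<lambda>x. x + ?o) ` H0)"
    using finH0 by (intro card_mono) auto
  also have "\<dots> \<le> card H0 + card H0"
    using card_Un_le[of H0 "(\<lambda>x. x + ?o) ` H0"] card_image_le[OF finH0, of "\<lambda>x. x + ?o"] by linarith
  finally have "2 * 2 ^ (n - 1) \<le> 2 * card H0"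
    using n by (simp add: card_configs flip: power_Suc)
  then have cH0: "2 ^ (n - 1) \<le> card H0" by simp
  \<comment> \<open>The representatives of the blocked pairs.\<close>
  define N where "N = (\<lambda>x. if x 1 = 0 then x else x + ?o) ` R"
  have "card N \<le> card R" unfolding N_def by (rule card_image_le[OF R(1)])
  then have "r \<le> card (H0 - N)"
    using cH0 R diff_card_le_card_Diff[of N H0] by (simp add: N_def)
  then obtain H where H: "H \<subseteq> H0 - N" "card H = r" by (meson obtain_subset_with_card_n)
  then have "finite H" using finH0 by (meson finite_Diff finite_subset)
  then obtain y where y: "bij_betw y {..<r} H"
    using finite_same_card_bij[of "{..<r}" H] H(2) by auto
  have yH: "y k \<in> H0" "y k \<notin> N" if "k < r" for k
    using y H(1) that by (auto simp: bij_betw_def)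
  show thesis
  proof
    show "inj_on y {..<r}" using y by (simp add: bij_betw_def)
    fix k assume k: "k < r"
    show yk: "y k \<in> configs n" "y k 1 = 0" using yH(1)[OF k] by (simp_all add: H0_def)
    show "y k \<notin> R"
    proof
      assume "y k \<in> R"
      then have "(if y k 1 = 0 then y k else y k + ?o) \<in> N" unfolding N_def by (rule imageI)
      then show False using yk yH(2)[OF k] by simp
    qed
    show "y k + ?o \<notin> R"
    proof
      assume "y k + ?o \<in> R"
      then have "(if (y k + ?o) 1 = 0 then y k + ?o else (y k + ?o) + ?o) \<in> N" unfolding N_def by (rule imageI)
      moreover have "(y k + ?o) 1 \<noteq> 0" using yk(2) o1 by simp
      ultimately have "y k + ?o + ?o \<in> N" by metis
      then show False using yH(2)[OF k] by (simp add: add.assoc)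
    qed
  qed
qed

lemma full_digraph_if_independent:
  assumes n: "n \<ge> 5" and f: "boolean_network n f"
    and A: "A \<subseteq> configs n" "f ` A \<inter> A = {}" "card A = 2 * n"
    and fibre: "\<And>c. card {x \<in> A. f x = c} < 2 * n"
  shows "full_digraph n \<in> interaction_graphs n f"
proof -
  let ?o = "all_ones n"
  have finA: "finite A" using A(1) finite_configs finite_subset by blast
  obtain B r where B: "B \<subseteq> A" "card (f ` B) = 2 * r" "card B = n + r"
    using even_image_subset[OF finA A(3) _ fibre] n by auto
  have finB: "finite B" using B(1) finA finite_subset by blast
  have r: "r \<le> n" using card_image_le[OF finB, of f] B by simp
  have "card {1..n} + r = card B" "card B \<le> 2 * n" using B r by simp_all
  from forest_placement[OF n finB B(2) order_refl this] obtain \<rho> \<tau> where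
    \<rho>: "inj_on \<rho> B" "\<rho> ` B \<subseteq> configs n" and
    \<tau>: "inj_on \<tau> (f ` B)" "\<tau> ` f ` B \<subseteq> {..<r} \<times> UNIV" and
    edge: "\<forall>j\<in>{1..n}. \<exists>p\<in>B. \<exists>q\<in>B. \<exists>k. \<rho> q = \<rho> p + unit_config j \<and>
      \<tau> (f p) = (k, True) \<and> \<tau> (f q) = (k, False)"
    by (elim exE conjE)
  \<comment> \<open>The forest has \<open>n + r \<le> 2 * n\<close> points and
    \<open>r \<le> n\<close> antipodal pairs are needed, so \<open>3 * n \<le> 2 ^ (n - 1)\<close>
    leaves enough room.\<close>
  have "6 * n \<le> 2 ^ n"
  proof (cases "n = 5")
    case False
    then have "6 * n \<le> n * n" using n by simp
    then show ?thesis using square_less_power2[OF n] by linarith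
  qed simp
  moreover have "(2::nat) ^ n = 2 * 2 ^ (n - 1)" using n by (simp flip: power_Suc)
  ultimately have "card (\<rho> ` B) + r \<le> 2 ^ (n - 1)" using B(3) r card_image[OF \<rho>(1)] by linarith
  with n finite_imageI[OF finB] obtain y where y: "inj_on y {..<r}"
    "\<And>k. k < r \<Longrightarrow> y k \<in> configs n" "\<And>k. k < r \<Longrightarrow> y k 1 = 0"
    "\<And>k. k < r \<Longrightarrow> y k \<notin> \<rho> ` B" "\<And>k. k < r \<Longrightarrow> y k + ?o \<notin> \<rho> ` B"
    by (rule free_antipodal_pairs) blast
  define z where "z = (\<lambda>(k, b). if b then y k else y k + ?o)"
  \<comment> \<open>The first coordinate recovers the Boolean label, which reduces injectivity of
    \<open>z\<close> to that of \<open>y\<close>.\<close>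
  have z_1: "z (k, b) 1 = (if b then 0 else 1)" if "k < r" for k b
    using y(3)[OF that] n by (simp add: z_def all_ones_apply)
  have inj_z: "inj_on z ({..<r} \<times> UNIV)"
  proof (rule inj_onI)
    fix u v assume uv: "u \<in> {..<r} \<times> UNIV" "v \<in> {..<r} \<times> UNIV" "z u = z v"
    obtain k b k' b' where eq: "u = (k, b)" "v = (k', b')" by fastforce
    have k: "k < r" "k' < r" using uv eq by auto
    have "b = b'" using z_1[OF k(1), of b] z_1[OF k(2), of b'] uv(3) eq by (auto split: if_splits)
    then have "y k = y k'" using uv(3) unfolding eq z_def by (cases b') simp_all
    then show "u = v" using y(1) k \<open>b = b'\<close> eq by (auto simp: inj_on_def)
  qed
  have z: "z u \<in> configs n" "z u \<notin> \<rho> ` B" if "u \<in> {..<r} \<times> UNIV" for u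
  proof -
    obtain k b where u: "u = (k, b)" "k < r" using \<open>u \<in> {..<r} \<times> UNIV\<close> by auto
    show "z u \<in> configs n"
      using u y(2) configs_add[OF y(2) all_ones_in_configs] by (simp add: z_def)
    show "z u \<notin> \<rho> ` B" using u y(4,5)[OF u(2)] by (cases b) (simp_all add: z_def)
  qed
  define g where "g v = (if v \<in> B then \<rho> v else z (\<tau> v))" for v
  have disj: "f ` B \<inter> B = {}" using A(2) B(1) by blast
  have g1: "g v = \<rho> v" if "v \<in> B" for v using that by (simp add: g_def)
  have g2: "g v = z (\<tau> v)" if "v \<in> f ` B" for v using that disj by (auto simp: g_def)
  have gB: "g ` B = \<rho> ` B" using g1 by (intro image_cong) auto
  have gfB: "g ` f ` B = z ` \<tau> ` f ` B" unfolding image_image[of z \<tau>] using g2 by (intro image_cong) auto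
  show ?thesis
  proof (rule full_digraph_if_placement[OF f, where S = "B \<union> f ` B" and g = g])
    show "B \<union> f ` B \<subseteq> configs n"
      using A(1) B(1) f by (auto simp: boolean_network_def)
    have zf: "z ` \<tau> ` f ` B \<inter> \<rho> ` B = {}" "z ` \<tau> ` f ` B \<subseteq> configs n"
      using \<tau>(2) z by blast+
    show "g ` (B \<union> f ` B) \<subseteq> configs n" unfolding image_Un gB gfB using zf \<rho>(2) by blast
    have "inj_on g B" using \<rho>(1) g1 by (simp add: inj_on_def)
    moreover have "inj_on g (f ` B)"
    proof -
      have "inj_on (z \<circ> \<tau>) (f ` B)" using \<tau> inj_z by (metis comp_inj_on inj_on_subset)
      then show ?thesis using g2 by (simp add: inj_on_def)
    qed
    moreover have "g ` (B - f ` B) \<inter> g ` (f ` B - B) = {}"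
      using zf(1) unfolding gB[symmetric] gfB[symmetric] by blast
    ultimately show "inj_on g (B \<union> f ` B)" by (simp add: inj_on_Un)
  next
    fix i j assume ij: "i \<in> {1..n}" "j \<in> {1..n}"
    from edge ij(2) obtain p q k where pq: "p \<in> B" "q \<in> B" "\<rho> q = \<rho> p + unit_config j"
      "\<tau> (f p) = (k, True)" "\<tau> (f q) = (k, False)" by blast
    have "g (f p) = y k" "g (f q) = y k + ?o" using g2 pq by (simp_all add: z_def)
    then have "g (f p) i \<noteq> g (f q) i" using ij(1) by (simp add: all_ones_apply)
    moreover have "g q = g p + unit_config j" using g1 pq by simp
    ultimately show "\<exists>p\<in>B \<union> f ` B. \<exists>q\<in>B \<union> f ` B. f p \<in> B \<union> f ` B \<and> f q \<in> B \<union> f ` B \<and>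
        g q = g p + unit_config j \<and> g (f p) i \<noteq> g (f q) i"
      using pq(1,2) by blast
  qed
qed

section \<open>Combining the cases\<close>

theorem theorem1:
  fixes n :: nat and f :: "(nat \<Rightarrow> bit) \<Rightarrow> (nat \<Rightarrow> bit)"
  assumes "n \<ge> 5"
    and "boolean_network n f"
    and "\<not> (\<exists>c. \<forall>x\<in>configs n. f x = c)"
    and "\<not> (\<forall>x\<in>configs n. f x = x)"
  shows "full_digraph n \<in> interaction_graphs n f"
proof (rule ccontr)
  assume neg: "full_digraph n \<notin> interaction_graphs n f"
  let ?F = "{x \<in> configs n. f x = x}" and ?P = "{x \<in> configs n. f x \<noteq> x}"
  obtain a where "a \<in> configs n" "f a \<noteq> a" using assms(4) by blast
  with neg assms(1,2) have F: "card ?F < 2 * n"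
    using full_digraph_if_many_fixpoints[of n f a] by linarith
  have fibre: "card {x \<in> configs n. f x = c} < n + 2" for c
  proof (cases "c \<in> configs n")
    case True
    obtain a where "a \<in> configs n" "f a \<noteq> c" using assms(3) by blast
    with True neg assms(1,2) show ?thesis
      using full_digraph_if_large_fibre[of n f a c] by linarith
  next
    case False
    then have "{x \<in> configs n. f x = c} = {}" using assms(2) by (auto simp: boolean_network_def)
    then show ?thesis by (simp only: card.empty)
  qed
  have "configs n = ?F \<union> ?P" "?F \<inter> ?P = {}" by auto
  then have FP: "card ?F + card ?P = 2 ^ n"
    using finite_configs[of n] card_Un_disjoint[of ?F ?P] card_configs[of n] by simp
  have "finite ?P" "\<forall>x\<in>?P. f x \<noteq> x" using finite_configs by auto
  from independent_set_and_triples[OF this] obtain A T where AT: "A \<subseteq> ?P" "f ` A \<inter> A = {}" "T \<subseteq> ?P"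
    "card ?P \<le> 2 * card A + card T"
    and triple: "\<forall>x\<in>T. {x, f x, f (f x)} \<subseteq> ?P \<and> x \<noteq> f x \<and> f x \<noteq> f (f x) \<and> x \<noteq> f (f x)"
    and disj: "\<forall>x\<in>T. \<forall>y\<in>T. x \<noteq> y \<longrightarrow> {x, f x, f (f x)} \<inter> {y, f y, f (f y)} = {}"
    by (elim exE conjE)
  have T: "card T < n"
  proof (rule ccontr)
    assume "\<not> card T < n"
    moreover have "T \<subseteq> configs n" using AT(3) by blast
    ultimately have "full_digraph n \<in> interaction_graphs n f"
      using triple disj by (intro full_digraph_if_disjoint_triples[OF assms(1,2)]) (simp, simp, meson, meson)
    with neg show False ..
  qed
  \<comment> \<open>With at most \<open>2 * n - 1\<close> fixed points and \<open>n - 1\<close>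
    triples, \<open>2 * card A \<ge> 2 ^ n - 3 * n + 2\<close>. This bound makes the right side at
    least \<open>4 * n - 1\<close>, which forces \<open>card A \<ge> 2 * n\<close>; equality holds
    for \<open>n = 5\<close>.\<close>
  have "7 * n \<le> 2 ^ n + 3"
  proof -
    consider "n = 5" | "n = 6" | "n \<ge> 7" using assms(1) by linarith
    then show ?thesis
    proof cases
      case 3
      then have "7 * n \<le> n * n" by simp
      then show ?thesis using square_less_power2[OF assms(1)] by linarith
    qed simp_all
  qed
  then have "2 * n \<le> card A" using F T FP AT(4) by linarith
  then obtain B where B: "B \<subseteq> A" "card B = 2 * n" by (meson obtain_subset_with_card_n)
  have BV: "B \<subseteq> configs n" using B(1) AT(1) by blast
  have "card {x \<in> B. f x = c} < 2 * n" for c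
  proof -
    have "card {x \<in> B. f x = c} \<le> card {x \<in> configs n. f x = c}"
      using BV finite_configs by (intro card_mono) auto
    with fibre[of c] show ?thesis using assms(1) by linarith
  qed
  moreover have "f ` B \<inter> B = {}" using AT(2) B(1) by blast
  ultimately show False
    using full_digraph_if_independent[OF assms(1,2) BV _ B(2)] neg by blast
qed

end
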